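(* Let $n\ge 2$, $R>0$, and suppose $f\in C^0((0,R))$ and there exists a constant $f_0>0$ such that $f\ge f_0$ on $[0,R]$. Let $u$ denote the convex (classical) solution of problem (P) and, for each $\varepsilon>0$, let $u^\varepsilon$ be the monotone increasing classical solution of problem $(P_\varepsilon)$. Then: (i) $u^0:=\lim_{\varepsilon\to 0^+}u^\varepsilon$ exists pointwise and $u^\varepsilon$ converges to $u^0$ uniformly on every compact subset of $(0,R)$ as $\varepsilon\to0^+$. Moreover, $u^0$ is strictly convex in every compact subset, hence it is strictly convex in $[0,R]$. (ii) $u^\varepsilon_r$ converges to $u^0_r$ weakly-$*$ in $L^\infty((0,R))$ as $\varepsilon\to 0^+$. (iii) $u^0\equiv u$.
   Context: All functions are functions of the radial variable $r\in[0,R]$; subscripts $r$ denote derivatives in $r$. Given $f$ and a number $g(R)\in\mathbb{R}$, problem (P) (the radial form of the Monge–Ampère problem $\det D^2u=f$ in the ball $B_R(0)\subset\mathbb{R}^n$, $u=g$ on the boundary) is: find $u$ with $\frac{1}{n r^{n-1}}\big((u_r)^n\big)_r=f$ in $(0,R)$, $u(R)=g(R)$, $u_r(0)=0$. For $\varepsilon>0$, problem $(P_\varepsilon)$ (the radial form of the vanishing moment approximation $-\varepsilon\Delta^2u^\varepsilon+\det D^2u^\varepsilon=f$, $u^\varepsilon=g$, $\Delta u^\varepsilon=\varepsilon$ on the boundary) is: find $u^\varepsilon$ with $-\frac{\varepsilon}{r^{n-1}}\Big(r^{n-1}\Big(\frac{1}{r^{n-1}}\big(r^{n-1}u^\varepsilon_r\big)_r\Big)_r\Big)_r+\frac{1}{n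 r^{n-1}}\big((u^\varepsilon_r)^n\big)_r=f$ in $(0,R)$, $u^\varepsilon(R)=g(R)$, $u^\varepsilon_r(0)=0$, $|u^\varepsilon_{rr}(0)|<\infty$, $|u^\varepsilon_{rrr}(r)|=o(r^{-(n-1)})$ as $r\to0^+$, and $u^\varepsilon_{rr}(R)+\frac{n-1}{R}u^\varepsilon_r(R)=\varepsilon$. A classical solution is one whose derivatives appearing in the problem exist and satisfy all equations and conditions pointwise. Convexity refers to the function of $r$. *)

theory Defs
  imports "HOL-Analysis.Analysis"
begin

definition strictly_convex_on :: "real set \<Rightarrow> (real \<Rightarrow> real) \<Rightarrow> bool" where
  "strictly_convex_on S h \<longleftrightarrow> convex S \<and>
     (\<forall>x\<in>S. \<forall>y\<in>S. \<forall>t. x \<noteq> y \<longrightarrow> 0 < t \<longrightarrow> t < 1 \<longrightarrow>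
        h ((1 - t) * x + t * y) < (1 - t) * h x + t * h y)"

text \<open>Classical solution of (P): radial Monge-Ampere problem on [0,R],
  u1 is u_r (one-sided derivatives at the endpoints).\<close>
definition classical_sol_P ::
  "nat \<Rightarrow> real \<Rightarrow> (real \<Rightarrow> real) \<Rightarrow> real \<Rightarrow> (real \<Rightarrow> real) \<Rightarrow> bool" where
  "classical_sol_P n R f gR u \<longleftrightarrow>
    (\<exists>u1 D.
      (\<forall>r\<in>{0..R}. (u has_real_derivative u1 r) (at r within {0..R})) \<and>
      (\<forall>r\<in>{0<..<R}. ((\<lambda>s. (u1 s) ^ n) has_real_derivative D r) (at r)) \<and>
      (\<forall>r\<in>{0<..<R}. 1 / (real n * r ^ (n - 1)) * D r = f r) \<and>
      u R = gR \<and> u1 0 = 0)"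

text \<open>Classical solution of (P_eps): u1,u2,u3 are u_r,u_rr,u_rrr;
  A = (r^(n-1) u_r)_r, B = (A / r^(n-1))_r, C = (r^(n-1) B)_r, D = ((u_r)^n)_r.
  Finiteness of u_rr(0) is expressed by existence of the one-sided derivative u2 0.\<close>
definition classical_sol_Peps ::
  "nat \<Rightarrow> real \<Rightarrow> (real \<Rightarrow> real) \<Rightarrow> real \<Rightarrow> real \<Rightarrow> (real \<Rightarrow> real) \<Rightarrow> bool" where
  "classical_sol_Peps n R f gR \<epsilon> u \<longleftrightarrow>
    (\<exists>u1 u2 u3 A B C D.
      (\<forall>r\<in>{0..R}. (u has_real_derivative u1 r) (at r within {0..R})) \<and>
      (\<forall>r\<in>{0..R}. (u1 has_real_derivative u2 r) (at r within {0..R})) \<and>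
      (\<forall>r\<in>{0<..<R}. (u2 has_real_derivative u3 r) (at r)) \<and>
      (\<forall>r\<in>{0<..<R}. ((\<lambda>s. s ^ (n - 1) * u1 s) has_real_derivative A r) (at r)) \<and>
      (\<forall>r\<in>{0<..<R}. ((\<lambda>s. A s / s ^ (n - 1)) has_real_derivative B r) (at r)) \<and>
      (\<forall>r\<in>{0<..<R}. ((\<lambda>s. s ^ (n - 1) * B s) has_real_derivative C r) (at r)) \<and>
      (\<forall>r\<in>{0<..<R}. ((\<lambda>s. (u1 s) ^ n) has_real_derivative D r) (at r)) \<and>
      (\<forall>r\<in>{0<..<R}. - (\<epsilon> / r ^ (n - 1)) * C r + 1 / (real n * r ^ (n - 1)) * D r = f r) \<and>
      u R = gR \<and> u1 0 = 0 \<and>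
      ((\<lambda>r. \<bar>u3 r\<bar> * r ^ (n - 1)) \<longlongrightarrow> 0) (at_right 0) \<and>
      u2 R + (real n - 1) / R * u1 R = \<epsilon>)"

end

theory Submission
  imports Defs
begin

text \<open>Write \<open>w\<close> and \<open>p\<close> for the radial derivatives of the solutions of the approximate problem and
  of the Monge-Ampere problem. Integrating the approximate equation once from \<open>0\<close> gives
  \<open>\<epsilon> r ^ (n - 1) (w'' + (n - 1) (w' / r - w / r\<^sup>2)) = (w ^ n - p ^ n) / n\<close>.
  The maximum principle, together with the boundary condition at \<open>R\<close>, bounds \<open>w\<close> uniformly in
  \<open>\<epsilon>\<close>, and comparison with parabolas on small intervals shows that \<open>w\<close> tends to \<open>p\<close> pointwise on
  \<open>{0<..<R}\<close>. Dominated convergence then yields both the weak-star convergence of the derivatives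
  and, since all solutions agree at \<open>R\<close>, the uniform convergence of the solutions. Strict convexity
  of the limit holds because \<open>p ^ n\<close>, and hence \<open>p\<close>, is strictly increasing.\<close>

section \<open>Calculus of one variable: extrema, mean values and convexity\<close>

text \<open>The mixed terms of the binomial expansion are nonnegative. This turns a gap between
  \<open>n\<close>-th powers into a gap between the bases that does not degenerate where a base is
  \<open>0\<close>.\<close>

lemma power_add_superadditive:
  fixes y d :: real
  assumes "0 \<le> y" "0 \<le> d" "1 \<le> n"
  shows "y ^ n + d ^ n \<le> (y + d) ^ n"
  using assms(3)
proof (induction n rule: nat_induct_at_least)
  case (Suc m)
  have "y ^ Suc m + d ^ Suc m \<le> (y + d) * (y ^ m + d ^ m)"
    using assms(1,2) by (simp add: algebra_simps)
  also have "\<dots> \<le> (y + d) * (y + d) ^ m"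
    using Suc.IH assms(1,2) by (intro mult_left_mono) auto
  finally show ?case by simp
qed simp

lemma has_real_derivative_interior_Icc:
  fixes h :: "real \<Rightarrow> real"
  assumes "(h has_real_derivative d) (at r within {a..b})" "r \<in> {a<..<b}"
  shows "(h has_real_derivative d) (at r)"
  using assms at_within_Icc_at[of a r b] by simp

lemma MVT_Icc:
  fixes h h' :: "real \<Rightarrow> real"
  assumes "\<And>r. r \<in> {a..b} \<Longrightarrow> (h has_real_derivative h' r) (at r within {a..b})"
    and "a \<le> x" "x < y" "y \<le> b"
  obtains z where "x < z" "z < y" "h y - h x = (y - x) * h' z"
proof -
  have "continuous_on {a..b} h"
    using assms(1) by (rule DERIV_continuous_on)
  then have cont: "continuous_on {x..y} h"
    by (rule continuous_on_subset) (use assms in auto)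
  have der: "(h has_real_derivative h' z) (at z)" if "x < z" "z < y" for z
    by (rule has_real_derivative_interior_Icc[of _ _ _ a b]) (use assms that in auto)
  obtain l z where z: "x < z" "z < y" "DERIV h z :> l" "h y - h x = (y - x) * l"
    using MVT[OF assms(3) cont] der real_differentiable_def by metis
  with der[of z] have "l = h' z" by (metis DERIV_unique)
  with z that show thesis by auto
qed

text \<open>Second-order test with the second derivative known only at \<open>\<xi>\<close>: if
  \<open>d\<close> were positive, \<open>g'\<close> would be positive just to the right of its zero
  \<open>\<xi>\<close>, and by the mean value theorem \<open>g\<close> would exceed its maximum
  there.\<close>

lemma second_derivative_nonpos_at_max:
  fixes g g' :: "real \<Rightarrow> real"
  assumes der: "\<And>x. x \<in> {a<..<b} \<Longrightarrow> (g has_real_derivative g' x) (at x)"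
    and der2: "(g' has_real_derivative d) (at \<xi>)"
    and \<xi>: "\<xi> \<in> {a<..<b}"
    and max: "\<And>x. x \<in> {a<..<b} \<Longrightarrow> g x \<le> g \<xi>"
  shows "g' \<xi> = 0" "d \<le> 0"
proof -
  have "\<bar>\<xi> - y\<bar> < min (\<xi> - a) (b - \<xi>) \<longrightarrow> g y \<le> g \<xi>" for y
    using max[of y] by (auto simp: abs_less_iff)
  then show 0: "g' \<xi> = 0"
    using \<xi> by (intro DERIV_local_max[OF der[OF \<xi>], of "min (\<xi> - a) (b - \<xi>)"]) auto
  show "d \<le> 0"
  proof (rule ccontr)
    assume "\<not> d \<le> 0"
    then obtain e where e: "e > 0" "\<And>h. h > 0 \<Longrightarrow> h < e \<Longrightarrow> g' \<xi> < g' (\<xi> + h)"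
      using DERIV_pos_inc_right[OF der2] by auto
    define x where "x = \<xi> + min (e / 2) ((b - \<xi>) / 2)"
    have x: "\<xi> < x" "x < b" "x < \<xi> + e"
      using e(1) \<xi> by (auto simp: x_def min_def field_simps)
    have "\<exists>z>\<xi>. z < x \<and> g x - g \<xi> = (x - \<xi>) * g' z"
      using x \<xi> by (intro MVT2 der) auto
    then obtain z where z: "\<xi> < z" "z < x" "g x - g \<xi> = (x - \<xi>) * g' z"
      by blast
    have "0 < g' z"
      using e(2)[of "z - \<xi>"] z x 0 by simp
    with z x have "g x > g \<xi>" by (smt (verit) mult_pos_pos)
    with max[of x] x \<xi> show False by auto
  qed
qed

text \<open>A negative left derivative would make \<open>h\<close> larger just to the left of
  \<open>b\<close>. This is the substitute for the second-derivative test when a maximum sits at the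
  end point.\<close>

lemma derivative_nonneg_at_right_end_max:
  fixes h :: "real \<Rightarrow> real"
  assumes "(h has_real_derivative d) (at b within {a..b})" "a < b"
    and max: "\<And>x. x \<in> {a..b} \<Longrightarrow> h x \<le> h b"
  shows "0 \<le> d"
proof (rule ccontr)
  assume "\<not> 0 \<le> d"
  then obtain e where e: "e > 0" "\<And>t. t > 0 \<Longrightarrow> b - t \<in> {a..b} \<Longrightarrow> t < e \<Longrightarrow> h b < h (b - t)"
    using has_real_derivative_neg_dec_left[OF assms(1)] by auto
  define t where "t = min (e / 2) (b - a)"
  have "t > 0" "b - t \<in> {a..b}" "t < e"
    using e(1) assms(2) by (auto simp: t_def min_def)
  with e(2)[of t] max[of "b - t"] show False by auto
qed

text \<open>The slope \<open>q\<close> of the chord separates the two derivatives: quotients from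
  \<open>x\<close> to the right are at most \<open>q\<close>, those from \<open>y\<close> to the
  left at least \<open>q\<close>. Limits within \<open>{x<..<y}\<close> keep the argument valid at
  the end points of \<open>{a..b}\<close>.\<close>

lemma convex_on_derivative_mono:
  fixes h h' :: "real \<Rightarrow> real"
  assumes conv: "convex_on {a..b} h"
    and der: "\<And>r. r \<in> {a..b} \<Longrightarrow> (h has_real_derivative h' r) (at r within {a..b})"
  shows "mono_on {a..b} h'"
proof (rule mono_onI)
  fix x y assume xy: "x \<in> {a..b}" "y \<in> {a..b}" "x \<le> y"
  show "h' x \<le> h' y"
  proof (cases "x = y")
    case False
    with xy have "x < y" by simp
    define q where "q = (h y - h x) / (y - x)"
    have sub: "{x<..<y} \<subseteq> {a..b}" using xy by auto
    have "((\<lambda>z. (h z - h x) / (z - x)) \<longlongrightarrow> h' x) (at x within {x<..<y})"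
      using has_field_derivative_subset[OF der[OF xy(1)] sub] by (simp add: has_field_derivative_iff)
    moreover have "\<forall>\<^sub>F z in at x within {x<..<y}. (h z - h x) / (z - x) \<le> q"
      unfolding eventually_at_filter
      using convex_on_slope_le(1)[OF conv xy(1,2)]
      by (intro always_eventually)
        (smt (verit, best) greaterThanLessThan_iff minus_diff_eq minus_divide_divide q_def)
    ultimately have "h' x \<le> q"
      using \<open>x < y\<close> by (intro tendsto_upperbound) (auto simp: at_within_eq_bot_iff)
    have "((\<lambda>z. (h z - h y) / (z - y)) \<longlongrightarrow> h' y) (at y within {x<..<y})"
      using has_field_derivative_subset[OF der[OF xy(2)] sub] by (simp add: has_field_derivative_iff)
    moreover have "\<forall>\<^sub>F z in at y within {x<..<y}. q \<le> (h z - h y) / (z - y)"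
      unfolding eventually_at_filter
      using convex_on_slope_le(2)[OF conv xy(1,2)]
      by (intro always_eventually)
        (smt (verit, best) greaterThanLessThan_iff minus_diff_eq minus_divide_divide q_def)
    ultimately have "q \<le> h' y"
      using \<open>x < y\<close> by (intro tendsto_lowerbound) (auto simp: at_within_eq_bot_iff)
    with \<open>h' x \<le> q\<close> show ?thesis by simp
  qed simp
qed

text \<open>Mean values on both sides of the intermediate point express the convexity defect as a
  positive multiple of a difference of \<open>h'\<close> at two interior points, so strict growth of
  \<open>h'\<close> on the open interval reaches up to the end points.\<close>

lemma strictly_convex_on_Icc:
  fixes h h' :: "real \<Rightarrow> real"
  assumes der: "\<And>r. r \<in> {a..b} \<Longrightarrow> (h has_real_derivative h' r) (at r within {a..b})"
    and mono: "strict_mono_on {a<..<b} h'"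
  shows "strictly_convex_on {a..b} h"
proof -
  have less: "h ((1 - t) * x + t * y) < (1 - t) * h x + t * h y"
    if xy: "a \<le> x" "x < y" "y \<le> b" and t: "0 < t" "t < 1" for x y t
  proof -
    define z where "z = (1 - t) * x + t * y"
    have z: "z - x = t * (y - x)" "y - z = (1 - t) * (y - x)"
      by (auto simp: z_def algebra_simps)
    with xy t have "x < z" "z < y"
      by (smt (verit) mult_pos_pos)+
    obtain \<xi> where \<xi>: "x < \<xi>" "\<xi> < z" "h z - h x = (z - x) * h' \<xi>"
      by (rule MVT_Icc[OF der, of x z]) (use xy \<open>x < z\<close> \<open>z < y\<close> in auto)
    obtain \<eta> where \<eta>: "z < \<eta>" "\<eta> < y" "h y - h z = (y - z) * h' \<eta>"
      by (rule MVT_Icc[OF der, of z y]) (use xy \<open>x < z\<close> \<open>z < y\<close> in auto)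
    have "h' \<xi> < h' \<eta>"
      by (rule strict_mono_onD[OF mono]) (use \<xi> \<eta> xy in auto)
    then have "0 < t * (1 - t) * (y - x) * (h' \<eta> - h' \<xi>)"
      using t xy by simp
    also have "\<dots> = t * (h y - h z) - (1 - t) * (h z - h x)"
      unfolding \<xi> \<eta> z by (simp add: algebra_simps)
    also have "\<dots> = (1 - t) * h x + t * h y - h z"
      by (simp add: algebra_simps)
    finally show ?thesis by (simp add: z_def)
  qed
  show ?thesis
    unfolding strictly_convex_on_def
  proof (intro conjI ballI allI impI)
    fix x y t :: real
    assume *: "x \<in> {a..b}" "y \<in> {a..b}" "x \<noteq> y" "0 < t" "t < 1"
    show "h ((1 - t) * x + t * y) < (1 - t) * h x + t * h y"
    proof (cases "x < y")
      case True
      with * less[of x y t] show ?thesis by simp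
    next
      case False
      with * less[of y x "1 - t"] show ?thesis by (simp add: algebra_simps)
    qed
  qed simp
qed

lemma strictly_convex_on_subset:
  assumes "strictly_convex_on S h" "K \<subseteq> S" "convex K"
  shows "strictly_convex_on K h"
  using assms unfolding strictly_convex_on_def by blast

section \<open>The gradient of the Monge-Ampere solution\<close>

text \<open>Convexity makes \<open>p\<close> increase from \<open>p 0 = 0\<close>, hence
  nonnegative, so that \<open>p\<close> is the \<open>n\<close>-th root of \<open>p ^ n\<close>. The
  equation makes \<open>p ^ n\<close> differentiable, whence continuity of \<open>p\<close>, with
  positive derivative, whence strict growth.\<close>

lemma classical_sol_P_gradient:
  fixes u f :: "real \<Rightarrow> real"
  assumes n: "n \<ge> 2" and R: "R > 0" and f0: "f0 > 0" and f_ge: "\<forall>r\<in>{0..R}. f r \<ge> f0"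
    and sol: "classical_sol_P n R f gR u" and conv: "convex_on {0..R} u"
  obtains p where
    "\<And>r. r \<in> {0..R} \<Longrightarrow> (u has_real_derivative p r) (at r within {0..R})"
    "\<And>r. r \<in> {0<..<R} \<Longrightarrow> ((\<lambda>s. p s ^ n) has_real_derivative real n * r ^ (n - 1) * f r) (at r)"
    "u R = gR" "p 0 = 0" "mono_on {0..R} p" "\<And>r. r \<in> {0..R} \<Longrightarrow> 0 \<le> p r"
    "(p \<longlongrightarrow> 0) (at_right 0)" "continuous_on {0<..<R} p" "strict_mono_on {0<..<R} p"
proof -
  obtain p D where
    der: "\<And>r. r \<in> {0..R} \<Longrightarrow> (u has_real_derivative p r) (at r within {0..R})"
    and D: "\<And>r. r \<in> {0<..<R} \<Longrightarrow> ((\<lambda>s. p s ^ n) has_real_derivative D r) (at r)"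
    and eq: "\<And>r. r \<in> {0<..<R} \<Longrightarrow> 1 / (real n * r ^ (n - 1)) * D r = f r"
    and bc: "u R = gR" "p 0 = 0"
    using sol unfolding classical_sol_P_def by blast
  have der_n: "((\<lambda>s. p s ^ n) has_real_derivative real n * r ^ (n - 1) * f r) (at r)"
    if "r \<in> {0<..<R}" for r
    using D[OF that] eq[OF that, symmetric] that n by simp
  have mono: "mono_on {0..R} p"
    by (rule convex_on_derivative_mono[OF conv der])
  have nonneg: "0 \<le> p r" if "r \<in> {0..R}" for r
    using mono_onD[OF mono, of 0 r] that bc by auto
  have lim: "(p \<longlongrightarrow> 0) (at_right 0)"
  proof (rule order_tendstoI)
    fix a :: real assume "a < 0"
    have "\<forall>\<^sub>F r in at_right 0. r \<in> {0<..<R}"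
      by (rule eventually_at_right_real[OF R])
    then show "\<forall>\<^sub>F r in at_right 0. a < p r"
      proof eventually_elim
      case (elim r)
      with nonneg[of r] \<open>a < 0\<close> show ?case by simp
    qed
  next
    fix a :: real assume "0 < a"
    \<comment> \<open>The derivative of \<open>u\<close> at \<open>0\<close> is \<open>0\<close>, so
      some difference quotient is below \<open>a\<close>. The mean value theorem turns it into a
      value \<open>p \<xi> < a\<close>, and monotonicity carries the bound to all of
      \<open>{0<..<\<xi>}\<close>.\<close>
    have "((\<lambda>z. (u z - u 0) / (z - 0)) \<longlongrightarrow> 0) (at 0 within {0..R})"
      using der[of 0] bc R by (simp add: has_field_derivative_iff)
    then have "\<forall>\<^sub>F z in at 0 within {0..R}. (u z - u 0) / (z - 0) < a"
      using \<open>0 < a\<close> by (rule order_tendstoD)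
    then have "\<forall>\<^sub>F z in at_right 0. (u z - u 0) / (z - 0) < a"
      using R at_within_Icc_at_right[of 0 R] by simp
    with eventually_at_right_real[OF R]
    have "\<forall>\<^sub>F z in at_right 0. z \<in> {0<..<R} \<and> (u z - u 0) / (z - 0) < a"
      by (rule eventually_conj)
    then obtain z where z: "z \<in> {0<..<R}" "(u z - u 0) / (z - 0) < a"
      by (metis (mono_tags, lifting) eventually_happens trivial_limit_at_right_real)
    obtain \<xi> where \<xi>: "0 < \<xi>" "\<xi> < z" "u z - u 0 = (z - 0) * p \<xi>"
      by (rule MVT_Icc[OF der, of 0 z]) (use z in auto)
    with z have "p \<xi> < a" by simp
    have "\<forall>\<^sub>F r in at_right 0. r \<in> {0<..<\<xi>}"
      by (rule eventually_at_right_real[OF \<xi>(1)])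
    then show "\<forall>\<^sub>F r in at_right 0. p r < a"
    proof eventually_elim
      case (elim r)
      with z \<xi> have "p r \<le> p \<xi>" by (intro mono_onD[OF mono]) auto
      with \<open>p \<xi> < a\<close> show ?case by simp
    qed
  qed
  have "continuous_on {0<..<R} (\<lambda>s. p s ^ n)"
    using der_n by (meson DERIV_isCont continuous_at_imp_continuous_on)
  then have "continuous_on {0<..<R} (\<lambda>s. root n (p s ^ n))"
    by (intro continuous_on_real_root)
  then have cont: "continuous_on {0<..<R} p"
    by (rule continuous_on_cong[THEN iffD1, rotated 2])
      (use n nonneg in \<open>auto intro!: real_root_power_cancel\<close>)
  have "p x < p y" if "x \<in> {0<..<R}" "y \<in> {0<..<R}" "x < y" for x y
  proof -
    have "\<exists>d. ((\<lambda>s. p s ^ n) has_real_derivative d) (at r) \<and> 0 < d" if r: "x \<le> r" "r \<le> y" for r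
    proof (intro exI conjI)
      have "r \<in> {0<..<R}" using r \<open>x \<in> _\<close> \<open>y \<in> _\<close> by auto
      then show "((\<lambda>s. p s ^ n) has_real_derivative real n * r ^ (n - 1) * f r) (at r)"
        by (rule der_n)
      have "f0 \<le> f r" using \<open>r \<in> _\<close> f_ge by simp
      then show "0 < real n * r ^ (n - 1) * f r"
        using \<open>r \<in> _\<close> f0 n by (intro mult_pos_pos) auto
    qed
    then have "p x ^ n < p y ^ n"
      by (rule DERIV_pos_imp_increasing[OF \<open>x < y\<close>])
    then show ?thesis
      by (rule power_less_imp_less_base) (use that nonneg in auto)
  qed
  then have "strict_mono_on {0<..<R} p"
    by (auto intro: strict_mono_onI)
  then show thesis
    using that der der_n bc mono nonneg lim cont by blast
qed

section \<open>A priori estimates for the approximate gradient\<close>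

text \<open>Maximum principle. At an interior maximum the left side of \<open>eq\<close> is
  nonpositive, so \<open>w \<le> p \<le> P\<close> there. At \<open>R\<close> the slope is
  nonnegative and the boundary condition leaves
  \<open>(real n - 1) * w R \<le> \<epsilon> * R\<close>. At \<open>0\<close> the value is
  \<open>0\<close>.\<close>

lemma gradient_bound:
  fixes w w1 w2 p :: "real \<Rightarrow> real"
  assumes n: "n \<ge> 2" and R: "R > 0" and eps: "0 < \<epsilon>"
    and w: "\<And>r. r \<in> {0..R} \<Longrightarrow> (w has_real_derivative w1 r) (at r within {0..R})"
    and w1: "\<And>r. r \<in> {0<..<R} \<Longrightarrow> (w1 has_real_derivative w2 r) (at r)"
    and eq: "\<And>r. r \<in> {0<..<R} \<Longrightarrow>
      \<epsilon> * r ^ (n - 1) * (w2 r + (real n - 1) * (w1 r / r - w r / r\<^sup>2)) = (w r ^ n - p r ^ n) / real n"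
    and nonneg: "\<And>r. r \<in> {0<..<R} \<Longrightarrow> 0 \<le> w r"
    and bc: "w 0 = 0" "w1 R + (real n - 1) / R * w R = \<epsilon>"
    and p: "\<And>r. r \<in> {0<..<R} \<Longrightarrow> 0 \<le> p r \<and> p r \<le> P"
    and r: "r \<in> {0..R}"
  shows "w r \<le> max P (\<epsilon> * R)"
proof -
  have "continuous_on {0..R} w"
    using w by (rule DERIV_continuous_on)
  then obtain \<xi> where \<xi>: "\<xi> \<in> {0..R}" "\<And>x. x \<in> {0..R} \<Longrightarrow> w x \<le> w \<xi>"
    using continuous_attains_sup[of "{0..R}" w] R by auto
  consider "\<xi> = 0" | "\<xi> = R" | "\<xi> \<in> {0<..<R}" using \<xi> by force
  then have "w \<xi> \<le> max P (\<epsilon> * R)"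
  proof cases
    case 1
    have "0 \<le> \<epsilon> * R" using eps R by simp
    then show ?thesis using 1 bc by simp
  next
    case 2
    have "0 \<le> w1 R"
      by (rule derivative_nonneg_at_right_end_max[OF w[of R]]) (use R \<xi> 2 in auto)
    then have "0 \<le> R * w1 R" using R by simp
    also have "\<dots> = \<epsilon> * R - (real n - 1) * w R" using bc R by (simp add: field_simps)
    finally have "(real n - 1) * w R \<le> \<epsilon> * R" by simp
    \<comment> \<open>Here \<open>real n - 1\<close> is at least \<open>1\<close>, and
      \<open>w R \<ge> w 0 = 0\<close> because the maximum sits at \<open>R\<close>.\<close>
    moreover have "w R \<le> (real n - 1) * w R"
      using mult_right_mono[of 1 "real n - 1" "w R"] n bc(1) \<xi>(2)[of 0] 2 R by simp
    ultimately show ?thesis using 2 by simp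
  next
    case 3
    note max = second_derivative_nonpos_at_max[OF has_real_derivative_interior_Icc[OF w] w1[OF 3] 3]
    have "w1 \<xi> = 0" "w2 \<xi> \<le> 0"
      by (rule max; use \<xi> in auto)+
    moreover have "0 \<le> (real n - 1) * (w \<xi> / \<xi>\<^sup>2)"
      using n nonneg[OF 3] by simp
    ultimately have "w2 \<xi> + (real n - 1) * (w1 \<xi> / \<xi> - w \<xi> / \<xi>\<^sup>2) \<le> 0"
      by (simp add: algebra_simps)
    then have "\<epsilon> * \<xi> ^ (n - 1) * (w2 \<xi> + (real n - 1) * (w1 \<xi> / \<xi> - w \<xi> / \<xi>\<^sup>2)) \<le> 0"
      using eps 3 by (intro mult_nonneg_nonpos) auto
    then have "w \<xi> ^ n \<le> p \<xi> ^ n"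
      unfolding eq[OF 3] using n by (simp add: divide_le_0_iff)
    moreover have "n = Suc (n - 1)" using n by simp
    ultimately have "w \<xi> ^ Suc (n - 1) \<le> p \<xi> ^ Suc (n - 1)" by simp
    then have "w \<xi> \<le> p \<xi>"
      by (rule power_le_imp_le_base) (use p[OF 3] in auto)
    then show ?thesis using p[OF 3] by auto
  qed
  with \<xi>(2)[OF r] show ?thesis by simp
qed

text \<open>The barriers are the parabolas \<open>q \<plusminus> (\<delta> + K (r - c)\<^sup>2)\<close> centred at the midpoint
  \<open>c\<close> of \<open>{a..b}\<close>, with \<open>K\<close> so large that \<open>w\<close> cannot reach them at the end points. Where \<open>w\<close>
  touches a translate of the barrier, \<open>\<bar>w ^ n - p ^ n\<bar>\<close> would be at least \<open>\<delta> ^ n\<close> although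
  the equation makes it \<open>O(\<epsilon>)\<close>.\<close>

lemma barriers:
  fixes w w1 w2 p :: "real \<Rightarrow> real"
  assumes n: "n \<ge> 2" and ab: "0 < a" "a < b" and eps: "0 < \<epsilon>" and delta: "0 < \<delta>"
    and w: "\<And>r. r \<in> {a..b} \<Longrightarrow> (w has_real_derivative w1 r) (at r)"
    and w1: "\<And>r. r \<in> {a..b} \<Longrightarrow> (w1 has_real_derivative w2 r) (at r)"
    and eq: "\<And>r. r \<in> {a..b} \<Longrightarrow>
      \<epsilon> * r ^ (n - 1) * (w2 r + (real n - 1) * (w1 r / r - w r / r\<^sup>2)) = (w r ^ n - p r ^ n) / real n"
    and wM: "\<And>r. r \<in> {a..b} \<Longrightarrow> 0 \<le> w r \<and> w r \<le> M"
    and p: "\<And>r. r \<in> {a..b} \<Longrightarrow> 0 \<le> p r \<and> q \<le> p r \<and> p r \<le> Q" and q: "q \<le> M"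
    and K: "K = 4 * M / (b - a)\<^sup>2"
    and C: "C = 2 * K + (real n - 1) * (K * (b - a) / a + M / a\<^sup>2)"
    and small: "real n * b ^ (n - 1) * C * \<epsilon> < \<delta> ^ n"
  shows "w ((a + b) / 2) \<le> Q + \<delta>" "q - \<delta> \<le> w ((a + b) / 2)"
proof -
  define c where "c = (a + b) / 2"
  have c: "c \<in> {a..b}" using ab by (auto simp: c_def)
  have M: "0 \<le> M" using wM[OF c] by simp
  have K0: "0 \<le> K" using M by (simp add: K)
  have n1: "0 \<le> real n - 1" using n by simp
  have C0: "0 \<le> C" using K0 M n1 ab by (simp add: C)
  \<comment> \<open>The factor \<open>4\<close> in \<open>K\<close> compensates the squared
    half-length \<open>(b - a)\<^sup>2 / 4\<close>: the parabola rises by exactly \<open>M\<close>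
    from the centre to either end.\<close>
  have ends: "K * (a - c)\<^sup>2 = M" "K * (b - c)\<^sup>2 = M"
  proof -
    have "(b - c)\<^sup>2 = (b - a)\<^sup>2 / 4" "(a - c)\<^sup>2 = (b - a)\<^sup>2 / 4"
      by (auto simp: c_def power2_eq_square field_simps)
    then show "K * (a - c)\<^sup>2 = M" "K * (b - c)\<^sup>2 = M"
      using ab by (simp_all only: K) simp_all
  qed
  have slope: "\<bar>2 * K * (r - c) / r\<bar> \<le> K * (b - a) / a" if "r \<in> {a..b}" for r
  proof -
    have "\<bar>2 * K * (r - c)\<bar> = K * (2 * \<bar>r - c\<bar>)"
      using K0 by (simp add: abs_mult)
    also have "\<dots> \<le> K * (b - a)"
      using K0 that by (intro mult_left_mono) (auto simp: c_def abs_if field_simps)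
    finally have *: "\<bar>2 * K * (r - c)\<bar> \<le> K * (b - a)" .
    have "\<bar>2 * K * (r - c)\<bar> / r \<le> K * (b - a) / a"
      using * that ab K0 by (intro frac_le) auto
    then show ?thesis using that ab by (simp add: abs_divide)
  qed
  have parab: "((\<lambda>r. K * (r - c)\<^sup>2) has_real_derivative 2 * K * (r - c)) (at r)" for r
    by (auto intro!: derivative_eq_intros)
  have parab': "((\<lambda>r. 2 * K * (r - c)) has_real_derivative 2 * K) (at r)" for r
    by (auto intro!: derivative_eq_intros)
  \<comment> \<open>\<open>C\<close> will dominate the bracket of \<open>eq\<close> at a touching
    point, with the sign that the respective barrier calls for. Replacing \<open>r\<close> by
    \<open>b\<close> makes the smallness of \<open>\<epsilon>\<close> uniform on the
    interval.\<close>
  have bound: "\<epsilon> * r ^ (n - 1) * C < \<delta> ^ n / real n" if "r \<in> {a..b}" for r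
  proof -
    have "\<epsilon> * r ^ (n - 1) * C \<le> \<epsilon> * b ^ (n - 1) * C"
      using that ab eps C0 by (intro mult_right_mono mult_left_mono power_mono) auto
    also have "\<dots> < \<delta> ^ n / real n"
      using small n by (simp add: field_simps)
    finally show ?thesis .
  qed
  have cont: "continuous_on {a..b} w"
    using w by (meson DERIV_isCont continuous_at_imp_continuous_on)
  have cont_parab: "continuous_on {a..b} (\<lambda>r. K * (r - c)\<^sup>2)"
    by (intro continuous_intros)
  have upper: "w c \<le> Q + \<delta>"
  proof (rule ccontr)
    assume neg: "\<not> w c \<le> Q + \<delta>"
    obtain \<xi> where \<xi>: "\<xi> \<in> {a..b}"
      "\<And>x. x \<in> {a..b} \<Longrightarrow> w x - K * (x - c)\<^sup>2 \<le> w \<xi> - K * (\<xi> - c)\<^sup>2"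
      using continuous_attains_sup[of "{a..b}" "\<lambda>x. w x - K * (x - c)\<^sup>2"]
        continuous_on_diff[OF cont cont_parab] ab by auto
    have big: "w \<xi> - K * (\<xi> - c)\<^sup>2 > Q + \<delta>" using \<xi>(2)[OF c] neg by simp
    have "0 \<le> Q" using p[OF c] by simp
    \<comment> \<open>At an end point the maximised quantity is at most \<open>M - M = 0\<close>,
      which is below \<open>Q + \<delta>\<close>.\<close>
    then have "\<xi> \<noteq> a" "\<xi> \<noteq> b" using big ends wM[of a] wM[of b] ab delta by auto
    with \<xi> have 3: "\<xi> \<in> {a<..<b}" by auto
    have "w1 \<xi> - 2 * K * (\<xi> - c) = 0" "w2 \<xi> - 2 * K \<le> 0"
      by (rule second_derivative_nonpos_at_max[where g = "\<lambda>x. w x - K * (x - c)\<^sup>2"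
            and g' = "\<lambda>x. w1 x - 2 * K * (x - c)" and d = "w2 \<xi> - 2 * K" and a = a and b = b and \<xi> = \<xi>];
          use 3 \<xi> in \<open>auto intro!: DERIV_diff w w1 parab parab'\<close>)+
    then have w12: "w1 \<xi> = 2 * K * (\<xi> - c)" "w2 \<xi> \<le> 2 * K" by auto
    have "w1 \<xi> / \<xi> - w \<xi> / \<xi>\<^sup>2 \<le> K * (b - a) / a + M / a\<^sup>2"
    proof -
      have "0 \<le> w \<xi> / \<xi>\<^sup>2" "0 \<le> M / a\<^sup>2" using wM[OF \<xi>(1)] M by auto
      moreover have "w1 \<xi> / \<xi> \<le> K * (b - a) / a"
        unfolding w12(1) by (rule abs_le_D1[OF slope[OF \<xi>(1)]])
      ultimately show ?thesis by linarith
    qed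
    then have "w2 \<xi> + (real n - 1) * (w1 \<xi> / \<xi> - w \<xi> / \<xi>\<^sup>2) \<le> C"
      unfolding C by (intro add_mono[OF w12(2)] mult_left_mono[OF _ n1])
    then have "(w \<xi> ^ n - p \<xi> ^ n) / real n \<le> \<epsilon> * \<xi> ^ (n - 1) * C"
      unfolding eq[OF \<xi>(1), symmetric] using eps \<xi> ab by (intro mult_left_mono) auto
    then have "(w \<xi> ^ n - p \<xi> ^ n) / real n < \<delta> ^ n / real n"
      using bound[OF \<xi>(1)] by linarith
    then have "w \<xi> ^ n < p \<xi> ^ n + \<delta> ^ n"
      using n by (simp add: divide_less_cancel split: if_splits)
    also have "\<dots> \<le> (p \<xi> + \<delta>) ^ n"
      using p[OF \<xi>(1)] delta n by (intro power_add_superadditive) auto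
    finally have "w \<xi> < p \<xi> + \<delta>"
      by (rule power_less_imp_less_base) (use p[OF \<xi>(1)] delta in auto)
    moreover have "0 \<le> K * (\<xi> - c)\<^sup>2" using K0 by simp
    ultimately show False using big p[OF \<xi>(1)] by linarith
  qed
  have lower: "q - \<delta> \<le> w c"
  proof (rule ccontr)
    assume neg: "\<not> q - \<delta> \<le> w c"
    obtain \<xi> where \<xi>: "\<xi> \<in> {a..b}"
      "\<And>x. x \<in> {a..b} \<Longrightarrow> - w x - K * (x - c)\<^sup>2 \<le> - w \<xi> - K * (\<xi> - c)\<^sup>2"
      using continuous_attains_sup[of "{a..b}" "\<lambda>x. - w x - K * (x - c)\<^sup>2"]
        continuous_on_diff[OF continuous_on_minus[OF cont] cont_parab] ab by auto
    have big: "w \<xi> + K * (\<xi> - c)\<^sup>2 < q - \<delta>" using \<xi>(2)[OF c] neg by simp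
    \<comment> \<open>At an end point \<open>w\<close> plus the parabola is at least
      \<open>M\<close>, while \<open>q - \<delta> < q \<le> M\<close>.\<close>
    then have "\<xi> \<noteq> a" "\<xi> \<noteq> b" using q ends wM[of a] wM[of b] ab delta by auto
    with \<xi> have 3: "\<xi> \<in> {a<..<b}" by auto
    have "- w1 \<xi> - 2 * K * (\<xi> - c) = 0" "- w2 \<xi> - 2 * K \<le> 0"
      by (rule second_derivative_nonpos_at_max[where g = "\<lambda>x. - w x - K * (x - c)\<^sup>2"
            and g' = "\<lambda>x. - w1 x - 2 * K * (x - c)" and d = "- w2 \<xi> - 2 * K" and a = a and b = b and \<xi> = \<xi>];
          use 3 \<xi> in \<open>auto intro!: DERIV_diff DERIV_minus w w1 parab parab'\<close>)+
    then have w12: "w1 \<xi> = - (2 * K * (\<xi> - c))" "- w2 \<xi> \<le> 2 * K" by auto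
    have "- (w1 \<xi> / \<xi>) + w \<xi> / \<xi>\<^sup>2 \<le> K * (b - a) / a + M / a\<^sup>2"
    proof -
      \<comment> \<open>The zeroth-order term has the favourable sign for the upper barrier and the
        unfavourable one here; the summand \<open>M / a\<^sup>2\<close> of \<open>C\<close> absorbs
        it.\<close>
      have "w \<xi> / \<xi>\<^sup>2 \<le> M / a\<^sup>2"
        using wM[OF \<xi>(1)] \<xi>(1) ab by (intro frac_le power_mono) auto
      moreover have "- (w1 \<xi> / \<xi>) \<le> K * (b - a) / a"
        unfolding w12(1) minus_divide_left minus_minus by (rule abs_le_D1[OF slope[OF \<xi>(1)]])
      ultimately show ?thesis by linarith
    qed
    then have "- w2 \<xi> + (real n - 1) * (- (w1 \<xi> / \<xi>) + w \<xi> / \<xi>\<^sup>2) \<le> C"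
      unfolding C by (intro add_mono[OF w12(2)] mult_left_mono[OF _ n1])
    then have "- (w2 \<xi> + (real n - 1) * (w1 \<xi> / \<xi> - w \<xi> / \<xi>\<^sup>2)) \<le> C"
      by (simp add: algebra_simps)
    then have "\<epsilon> * \<xi> ^ (n - 1) * - (w2 \<xi> + (real n - 1) * (w1 \<xi> / \<xi> - w \<xi> / \<xi>\<^sup>2))
        \<le> \<epsilon> * \<xi> ^ (n - 1) * C"
      using eps \<xi> ab by (intro mult_left_mono) auto
    then have "- ((w \<xi> ^ n - p \<xi> ^ n) / real n) \<le> \<epsilon> * \<xi> ^ (n - 1) * C"
      unfolding eq[OF \<xi>(1), symmetric] by (simp add: algebra_simps)
    then have "(p \<xi> ^ n - w \<xi> ^ n) / real n < \<delta> ^ n / real n"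
      using bound[OF \<xi>(1)] by (simp add: minus_divide_left)
    then have "p \<xi> ^ n < w \<xi> ^ n + \<delta> ^ n"
      using n by (simp add: divide_less_cancel split: if_splits)
    \<comment> \<open>The base is now \<open>w\<close>, the smaller of the two functions at
      \<open>\<xi>\<close>, so this uses \<open>w \<ge> 0\<close>.\<close>
    also have "\<dots> \<le> (w \<xi> + \<delta>) ^ n"
      using wM[OF \<xi>(1)] delta n by (intro power_add_superadditive) auto
    finally have "p \<xi> < w \<xi> + \<delta>"
      by (rule power_less_imp_less_base) (use wM[OF \<xi>(1)] delta in auto)
    moreover have "0 \<le> K * (\<xi> - c)\<^sup>2" using K0 by simp
    ultimately show False using big p[OF \<xi>(1)] by linarith
  qed
  show "w ((a + b) / 2) \<le> Q + \<delta>" "q - \<delta> \<le> w ((a + b) / 2)"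
    using upper lower by (simp_all add: c_def)
qed

text \<open>Away from \<open>n = 2\<close> both summands tend to \<open>0\<close> separately. For \<open>n = 2\<close> the claim says that
  \<open>w1\<close> is continuous at \<open>0\<close>: on \<open>{r / 2..r}\<close> it oscillates by \<open>o(1)\<close>, and it attains the
  difference quotient of \<open>w\<close> there.\<close>

lemma slope_defect_tendsto_0:
  fixes w w1 w2 :: "real \<Rightarrow> real"
  assumes n: "n \<ge> 2" and R: "R > 0"
    and w: "\<And>r. r \<in> {0..R} \<Longrightarrow> (w has_real_derivative w1 r) (at r within {0..R})"
    and w1: "\<And>r. r \<in> {0<..<R} \<Longrightarrow> (w1 has_real_derivative w2 r) (at r)"
    and w0: "w 0 = 0"
    and w2: "((\<lambda>r. \<bar>w2 r\<bar> * r ^ (n - 1)) \<longlongrightarrow> 0) (at_right 0)"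
  shows "((\<lambda>r. r ^ (n - 2) * (w1 r - w r / r)) \<longlongrightarrow> 0) (at_right 0)"
proof (rule tendstoI)
  fix e :: real assume "0 < e"
  \<comment> \<open>Two errors will be added, one below \<open>2 ^ (n - 1) * e'\<close> and the
    other below \<open>e'\<close>.\<close>
  define e' where "e' = e / (2 ^ (n - 1) + 1)"
  have e': "0 < e'" "e = 2 ^ (n - 1) * e' + e'"
  proof -
    have "0 < (2::real) ^ (n - 1) + 1" by (simp add: add_pos_pos)
    then show "0 < e'" "e = 2 ^ (n - 1) * e' + e'"
      using \<open>0 < e\<close> unfolding e'_def by (simp_all add: divide_simps) (simp add: algebra_simps)
  qed
  have q: "((\<lambda>r. w r / r) \<longlongrightarrow> w1 0) (at_right 0)"
    using w[of 0] w0 R at_within_Icc_at_right[of 0 R] by (simp add: has_field_derivative_iff)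
  have half: "filterlim (\<lambda>r::real. r / 2) (at_right 0) (at_right 0)"
    unfolding filterlim_at by (auto intro!: tendsto_eq_intros simp: eventually_at_filter)
  have "((\<lambda>r. w r / r - w (r / 2) / (r / 2)) \<longlongrightarrow> w1 0 - w1 0) (at_right 0)"
    by (rule tendsto_diff[OF q filterlim_compose[OF q half]])
  then have k: "\<forall>\<^sub>F r in at_right 0. dist (w r / r - w (r / 2) / (r / 2)) 0 < e'"
    using e' by (intro tendstoD) auto
  have "\<forall>\<^sub>F r in at_right 0. dist (\<bar>w2 r\<bar> * r ^ (n - 1)) 0 < e'"
    using w2 e' by (intro tendstoD) auto
  then obtain d where d: "d > 0" "\<And>r. 0 < r \<Longrightarrow> r < d \<Longrightarrow> \<bar>w2 r\<bar> * r ^ (n - 1) < e'"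
    unfolding eventually_at_right_field by auto
  have "\<forall>\<^sub>F r in at_right 0. r \<in> {0<..<min (min d 1) R}"
    by (rule eventually_at_right_real) (use d R in auto)
  with k show "\<forall>\<^sub>F r in at_right 0. dist (r ^ (n - 2) * (w1 r - w r / r)) 0 < e"
  proof eventually_elim
    case (elim r)
    then have r: "0 < r" "r < d" "r < 1" "r < R" by auto
    \<comment> \<open>At \<open>\<xi>\<close> the derivative equals the difference quotient of
      \<open>w\<close> over \<open>{r / 2..r}\<close>; staying above \<open>r / 2\<close> keeps
      \<open>\<xi>\<close> comparable with \<open>r\<close>.\<close>
    obtain \<xi> where \<xi>: "r / 2 < \<xi>" "\<xi> < r" "w r - w (r / 2) = (r - r / 2) * w1 \<xi>"
      by (rule MVT_Icc[OF w, of "r / 2" r]) (use r in auto)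
    have "\<exists>z>\<xi>. z < r \<and> w1 r - w1 \<xi> = (r - \<xi>) * w2 z"
      using r \<xi> by (intro MVT2 w1) auto
    then obtain \<eta> where \<eta>: "\<xi> < \<eta>" "\<eta> < r" "w1 r - w1 \<xi> = (r - \<xi>) * w2 \<eta>"
      by blast
    have pow: "r * r ^ (n - 2) = r ^ (n - 1)"
      using n by (cases n; cases "n - 1") auto
    have "\<bar>r ^ (n - 2) * (w1 r - w1 \<xi>)\<bar> = r ^ (n - 2) * (r - \<xi>) * \<bar>w2 \<eta>\<bar>"
      using r \<xi> \<eta> by (simp add: abs_mult)
    also have "\<dots> \<le> r ^ (n - 2) * r * \<bar>w2 \<eta>\<bar>"
      using r \<xi> by (intro mult_right_mono mult_left_mono) auto
    also have "\<dots> = r ^ (n - 1) * \<bar>w2 \<eta>\<bar>"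
      using pow by (simp add: mult.commute)
    \<comment> \<open>Since \<open>\<eta> > r / 2\<close>, \<open>r\<close> may be replaced by
      \<open>2 * \<eta>\<close>. This produces the weight at \<open>\<eta>\<close> that the growth
      condition on \<open>w2\<close> controls, at the cost of the factor
      \<open>2 ^ (n - 1)\<close>.\<close>
    also have "\<dots> \<le> (2 * \<eta>) ^ (n - 1) * \<bar>w2 \<eta>\<bar>"
      using r \<xi> \<eta> by (intro mult_right_mono power_mono) auto
    also have "\<dots> = 2 ^ (n - 1) * (\<bar>w2 \<eta>\<bar> * \<eta> ^ (n - 1))"
      by (simp add: power_mult_distrib)
    also have "\<dots> < 2 ^ (n - 1) * e'"
      using d(2)[of \<eta>] r \<xi> \<eta> by (intro mult_strict_left_mono) auto
    finally have 1: "\<bar>r ^ (n - 2) * (w1 r - w1 \<xi>)\<bar> < 2 ^ (n - 1) * e'" .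
    \<comment> \<open>\<open>w1 \<xi>\<close> is twice the quotient at \<open>r\<close> minus the
      quotient at \<open>r / 2\<close>, and both quotients tend to \<open>w1 0\<close>.\<close>
    have "w1 \<xi> - w r / r = w r / r - w (r / 2) / (r / 2)"
      using \<xi>(3) r by (simp add: field_simps)
    then have "\<bar>w1 \<xi> - w r / r\<bar> < e'" using elim by simp
    moreover have "r ^ (n - 2) \<le> 1" using r by (intro power_le_one) auto
    ultimately have 2: "\<bar>r ^ (n - 2) * (w1 \<xi> - w r / r)\<bar> < e'"
      using r mult_left_le_one_le[of "\<bar>w1 \<xi> - w r / r\<bar>" "r ^ (n - 2)"] by (simp add: abs_mult)
    have "r ^ (n - 2) * (w1 r - w r / r) = r ^ (n - 2) * (w1 r - w1 \<xi>) + r ^ (n - 2) * (w1 \<xi> - w r / r)"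
      by (simp add: algebra_simps)
    then show ?case using 1 2 e'(2) unfolding dist_real_def by linarith
  qed
qed

section \<open>The approximate problem: first integral and pointwise limit of the gradient\<close>

text \<open>Collects what the comparison uses of the limit gradient, without reference to
  \<open>u\<close> or to \<open>\<epsilon>\<close>.\<close>

locale radial_monge_ampere_gradient =
  fixes n :: nat and R :: real and f p :: "real \<Rightarrow> real"
  assumes n: "n \<ge> 2" and R: "R > 0"
    and deriv_p: "\<And>r. r \<in> {0<..<R} \<Longrightarrow>
      ((\<lambda>s. p s ^ n) has_real_derivative real n * r ^ (n - 1) * f r) (at r)"
    and mono_p: "mono_on {0..R} p" and p_nonneg: "\<And>r. r \<in> {0..R} \<Longrightarrow> 0 \<le> p r"
    and lim_p: "(p \<longlongrightarrow> 0) (at_right 0)" and cont_p: "continuous_on {0<..<R} p"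
begin

text \<open>Both problems have the same \<open>f\<close>, so their difference, multiplied by
  \<open>r ^ (n - 1)\<close>, is an exact derivative. The resulting first integral is constant, and
  the conditions at the origin make its limit there \<open>0\<close>. What remains is a second-order
  equation for \<open>w\<close>.\<close>

lemma Peps_integrated:
  assumes sol: "classical_sol_Peps n R f gR \<epsilon> v"
  obtains w w1 w2 where
    "\<And>r. r \<in> {0..R} \<Longrightarrow> (v has_real_derivative w r) (at r within {0..R})"
    "\<And>r. r \<in> {0..R} \<Longrightarrow> (w has_real_derivative w1 r) (at r within {0..R})"
    "\<And>r. r \<in> {0<..<R} \<Longrightarrow> (w1 has_real_derivative w2 r) (at r)"
    "\<And>r. r \<in> {0<..<R} \<Longrightarrow>
      \<epsilon> * r ^ (n - 1) * (w2 r + (real n - 1) * (w1 r / r - w r / r\<^sup>2)) = (w r ^ n - p r ^ n) / real n"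
    "v R = gR" "w 0 = 0" "w1 R + (real n - 1) / R * w R = \<epsilon>"
proof -
  obtain w w1 w2 A B C D where
    v: "\<And>r. r \<in> {0..R} \<Longrightarrow> (v has_real_derivative w r) (at r within {0..R})"
    and w: "\<And>r. r \<in> {0..R} \<Longrightarrow> (w has_real_derivative w1 r) (at r within {0..R})"
    and w1: "\<And>r. r \<in> {0<..<R} \<Longrightarrow> (w1 has_real_derivative w2 r) (at r)"
    and A: "\<And>r. r \<in> {0<..<R} \<Longrightarrow> ((\<lambda>s. s ^ (n - 1) * w s) has_real_derivative A r) (at r)"
    and B: "\<And>r. r \<in> {0<..<R} \<Longrightarrow> ((\<lambda>s. A s / s ^ (n - 1)) has_real_derivative B r) (at r)"
    and C: "\<And>r. r \<in> {0<..<R} \<Longrightarrow> ((\<lambda>s. s ^ (n - 1) * B s) has_real_derivative C r) (at r)"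
    and D: "\<And>r. r \<in> {0<..<R} \<Longrightarrow> ((\<lambda>s. w s ^ n) has_real_derivative D r) (at r)"
    and eq: "\<And>r. r \<in> {0<..<R} \<Longrightarrow>
      - (\<epsilon> / r ^ (n - 1)) * C r + 1 / (real n * r ^ (n - 1)) * D r = f r"
    and bc: "v R = gR" "w 0 = 0" "w1 R + (real n - 1) / R * w R = \<epsilon>"
    and o: "((\<lambda>r. \<bar>w2 r\<bar> * r ^ (n - 1)) \<longlongrightarrow> 0) (at_right 0)"
    using sol unfolding classical_sol_Peps_def by (elim exE conjE) blast
  note w' = has_real_derivative_interior_Icc[OF w]
  obtain m where m: "n = Suc (Suc m)"
    using n by (metis add_2_eq_Suc nat_le_iff_add)
  \<comment> \<open>This is the radial Laplacian of \<open>v\<close>, and \<open>B\<close> is its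
    radial derivative. Uniqueness of derivatives makes both explicit.\<close>
  have A_eq: "A r / r ^ (n - 1) = w1 r + (real n - 1) * (w r / r)" if r: "r \<in> {0<..<R}" for r
  proof -
    have "(w has_real_derivative w1 r) (at r)"
      using r by (intro w') auto
    then have "((\<lambda>s. s ^ (n - 1) * w s) has_real_derivative
        (real n - 1) * r ^ m * w r + r ^ (n - 1) * w1 r) (at r)"
      unfolding m by (auto intro!: derivative_eq_intros simp del: power_Suc simp: algebra_simps)
    with A[OF r] have "A r = (real n - 1) * r ^ m * w r + r ^ (n - 1) * w1 r"
      by (rule DERIV_unique)
    then show ?thesis using r by (simp add: m field_simps)
  qed
  have B_eq: "B r = w2 r + (real n - 1) * (w1 r / r - w r / r\<^sup>2)" if r: "r \<in> {0<..<R}" for r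
  proof -
    have "(w has_real_derivative w1 r) (at r)"
      using r by (intro w') auto
    with w1[OF r] have "((\<lambda>s. w1 s + (real n - 1) * (w s / s)) has_real_derivative
        w2 r + (real n - 1) * (w1 r / r - w r / r\<^sup>2)) (at r)"
      using r by (auto intro!: derivative_eq_intros simp: field_simps power2_eq_square)
    moreover have "((\<lambda>s. w1 s + (real n - 1) * (w s / s)) has_real_derivative B r) (at r)"
      by (rule has_field_derivative_transform_within_open[OF B[OF r], of "{0<..<R}"])
        (use r A_eq in auto)
    ultimately show ?thesis by (metis DERIV_unique)
  qed
  \<comment> \<open>\<open>E\<close> integrates the equation times \<open>r ^ (n - 1)\<close>, with
    \<open>p r ^ n / real n\<close> as the antiderivative of
    \<open>r ^ (n - 1) * f r\<close>.\<close>
  define E where "E r = - \<epsilon> * (r ^ (n - 1) * B r) + w r ^ n / real n - p r ^ n / real n" for r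
  have "(E has_real_derivative 0) (at r)" if r: "r \<in> {0<..<R}" for r
  proof -
    have "(E has_real_derivative - \<epsilon> * C r + D r / real n - (real n * r ^ (n - 1) * f r) / real n) (at r)"
      unfolding E_def
      by (intro DERIV_diff DERIV_add DERIV_cmult DERIV_cdivide C D deriv_p r)
    moreover have "- \<epsilon> * C r + D r / real n - (real n * r ^ (n - 1) * f r) / real n = 0"
      unfolding eq[OF r, symmetric] using r n by (simp add: field_simps)
    ultimately show ?thesis by simp
  qed
  then have E_const: "E r = E (R / 2)" if "r \<in> {0<..<R}" for r
    using that R by (intro DERIV_isconst3[of 0 R]) auto
  have w_lim: "(w \<longlongrightarrow> 0) (at_right 0)"
  proof -
    have "continuous (at 0 within {0..R}) w"
      using w[of 0] R by (intro DERIV_continuous) auto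
    then show ?thesis
      using R at_within_Icc_at_right[of 0 R] bc by (simp add: continuous_within)
  qed
  have "((\<lambda>r. \<bar>w2 r * r ^ (n - 1)\<bar>) \<longlongrightarrow> 0) (at_right 0)"
    by (rule Lim_transform_eventually[OF o])
      (auto simp: eventually_at_filter abs_mult)
  then have o': "((\<lambda>r. w2 r * r ^ (n - 1)) \<longlongrightarrow> 0) (at_right 0)"
    by (rule tendsto_rabs_zero_cancel)
  note defect = slope_defect_tendsto_0[OF n R w w1 bc(2) o]
  \<comment> \<open>The flux splits into the third derivative of \<open>v\<close>, controlled by its
    growth condition, and the slope defect.\<close>
  have B_lim: "((\<lambda>r. r ^ (n - 1) * B r) \<longlongrightarrow> 0) (at_right 0)"
  proof (rule Lim_transform_eventually)
    show "((\<lambda>r. w2 r * r ^ (n - 1) + (real n - 1) * (r ^ (n - 2) * (w1 r - w r / r))) \<longlongrightarrow> 0) (at_right 0)"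
      using tendsto_add[OF o' tendsto_mult_left[OF defect, of "real n - 1"]] by simp
    have "\<forall>\<^sub>F r in at_right 0. r \<in> {0<..<R}"
      by (rule eventually_at_right_real[OF R])
    then show "\<forall>\<^sub>F r in at_right 0.
        w2 r * r ^ (n - 1) + (real n - 1) * (r ^ (n - 2) * (w1 r - w r / r)) = r ^ (n - 1) * B r"
      by eventually_elim (simp add: B_eq m field_simps power2_eq_square)
  qed
  have "(E \<longlongrightarrow> - \<epsilon> * 0 + 0 ^ n / real n - 0 ^ n / real n) (at_right 0)"
    unfolding E_def using n by (intro tendsto_intros B_lim w_lim lim_p) auto
  then have "(E \<longlongrightarrow> 0) (at_right 0)" using n by simp
  moreover have "\<forall>\<^sub>F r in at_right 0. E r = E (R / 2)"
    using eventually_at_right_real[OF R] by eventually_elim (rule E_const)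
  ultimately have "((\<lambda>_. E (R / 2)) \<longlongrightarrow> 0) (at_right (0::real))"
    by (rule Lim_transform_eventually)
  then have "E (R / 2) = 0"
    by (simp add: tendsto_const_iff)
  with E_const have E0: "E r = 0" if "r \<in> {0<..<R}" for r
    using that by simp
  have "\<epsilon> * r ^ (n - 1) * (w2 r + (real n - 1) * (w1 r / r - w r / r\<^sup>2)) = (w r ^ n - p r ^ n) / real n"
    if r: "r \<in> {0<..<R}" for r
    using E0[OF r] unfolding E_def B_eq[OF r] by (simp add: diff_divide_distrib mult.assoc)
  then show thesis
    using that v w w1 bc by blast
qed

text \<open>The gradient is named \<open>deriv v\<close>, as in the weak-star claim. With
  \<open>\<epsilon> < 1\<close> the bound \<open>\<epsilon> * R\<close> becomes \<open>R\<close>, so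
  the bound no longer depends on \<open>\<epsilon>\<close>. On \<open>{a..b}\<close> the increasing
  \<open>p\<close> lies between \<open>p a\<close> and \<open>p b\<close>, which become the levels
  \<open>q\<close> and \<open>Q\<close> of the barriers.\<close>

lemma Peps_gradient_facts:
  assumes sol: "classical_sol_Peps n R f gR \<epsilon> v" and mono: "mono_on {0..R} v"
    and eps: "0 < \<epsilon>" "\<epsilon> < 1"
  shows "continuous_on {0..R} v" "v R = gR" "continuous_on {0<..<R} (deriv v)"
    and "\<And>r. r \<in> {0<..<R} \<Longrightarrow> (v has_real_derivative deriv v r) (at r)"
    and "\<And>r. r \<in> {0<..<R} \<Longrightarrow> 0 \<le> deriv v r"
    and "\<And>r. r \<in> {0<..<R} \<Longrightarrow> deriv v r \<le> max (p R) R"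
    and "\<And>a b \<delta>. \<lbrakk>0 < a; a < b; b < R; 0 < \<delta>;
       real n * b ^ (n - 1) * (2 * (4 * max (p R) R / (b - a)\<^sup>2) + (real n - 1) *
         (4 * max (p R) R / (b - a)\<^sup>2 * (b - a) / a + max (p R) R / a\<^sup>2)) * \<epsilon> < \<delta> ^ n\<rbrakk> \<Longrightarrow>
       deriv v ((a + b) / 2) \<in> {p a - \<delta>..p b + \<delta>}"
proof -
  obtain w w1 w2 where
    v: "\<And>r. r \<in> {0..R} \<Longrightarrow> (v has_real_derivative w r) (at r within {0..R})"
    and w: "\<And>r. r \<in> {0..R} \<Longrightarrow> (w has_real_derivative w1 r) (at r within {0..R})"
    and w1: "\<And>r. r \<in> {0<..<R} \<Longrightarrow> (w1 has_real_derivative w2 r) (at r)"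
    and eq: "\<And>r. r \<in> {0<..<R} \<Longrightarrow>
      \<epsilon> * r ^ (n - 1) * (w2 r + (real n - 1) * (w1 r / r - w r / r\<^sup>2)) = (w r ^ n - p r ^ n) / real n"
    and bc: "v R = gR" "w 0 = 0" "w1 R + (real n - 1) / R * w R = \<epsilon>"
    using Peps_integrated[OF sol] by blast
  show "continuous_on {0..R} v" by (rule DERIV_continuous_on[OF v])
  show "v R = gR" by (rule bc)
  have v': "(v has_real_derivative w r) (at r)" if "r \<in> {0<..<R}" for r
    by (rule has_real_derivative_interior_Icc[OF v]) (use that in auto)
  then have deriv_v: "deriv v r = w r" if "r \<in> {0<..<R}" for r
    using that by (intro DERIV_imp_deriv)
  then show "\<And>r. r \<in> {0<..<R} \<Longrightarrow> (v has_real_derivative deriv v r) (at r)"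
    using v' by simp
  have "continuous_on {0..R} w" by (rule DERIV_continuous_on[OF w])
  then have "continuous_on {0<..<R} w" by (rule continuous_on_subset) auto
  then show "continuous_on {0<..<R} (deriv v)"
    by (rule continuous_on_cong[THEN iffD1, rotated 2]) (auto simp: deriv_v)
  have nonneg: "0 \<le> w r" if "r \<in> {0<..<R}" for r
    by (rule mono_on_imp_deriv_nonneg[OF mono v'[OF that]]) (use that in auto)
  then show "\<And>r. r \<in> {0<..<R} \<Longrightarrow> 0 \<le> deriv v r"
    by (simp add: deriv_v)
  have pR: "0 \<le> p r \<and> p r \<le> p R" if "r \<in> {0<..<R}" for r
    using p_nonneg mono_onD[OF mono_p, of r R] that by auto
  have upper: "w r \<le> max (p R) R" if "r \<in> {0<..<R}" for r
  proof -
    have "w r \<le> max (p R) (\<epsilon> * R)"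
      by (rule gradient_bound[OF n R eps(1) w w1 eq nonneg bc(2,3) pR]) (use that in auto)
    also have "\<epsilon> * R \<le> R" using eps R by simp
    finally show ?thesis by (auto simp: max_def split: if_splits)
  qed
  then show "\<And>r. r \<in> {0<..<R} \<Longrightarrow> deriv v r \<le> max (p R) R"
    by (simp add: deriv_v)
  fix a b \<delta> :: real
  assume ab: "0 < a" "a < b" "b < R" and delta: "0 < \<delta>"
    and small: "real n * b ^ (n - 1) * (2 * (4 * max (p R) R / (b - a)\<^sup>2) + (real n - 1) *
         (4 * max (p R) R / (b - a)\<^sup>2 * (b - a) / a + max (p R) R / a\<^sup>2)) * \<epsilon> < \<delta> ^ n"
  have sub: "r \<in> {0<..<R}" "r \<in> {0..R}" if "r \<in> {a..b}" for r
    using that ab by auto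
  have pab: "0 \<le> p r \<and> p a \<le> p r \<and> p r \<le> p b" if "r \<in> {a..b}" for r
    using that ab p_nonneg[of r] by (auto intro!: mono_onD[OF mono_p])
  have "p a \<le> max (p R) R" using pR[of a] ab by auto
  note bar = barriers[OF n ab(1,2) eps(1) delta has_real_derivative_interior_Icc[OF w] w1 eq _
      pab this refl refl small]
  have "w ((a + b) / 2) \<le> p b + \<delta>" "p a - \<delta> \<le> w ((a + b) / 2)"
    by (rule bar; use sub nonneg upper in blast)+
  then show "deriv v ((a + b) / 2) \<in> {p a - \<delta>..p b + \<delta>}"
    using ab by (simp add: deriv_v)
qed

text \<open>On a short symmetric interval around \<open>c\<close>, continuity keeps
  \<open>p a\<close> and \<open>p b\<close> within \<open>e / 2\<close> of \<open>p c\<close>; the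
  barriers contribute another \<open>e / 2\<close>. The interval is fixed before
  \<open>\<epsilon>\<close> tends to \<open>0\<close>, so the constant of the smallness condition is
  fixed too.\<close>

lemma deriv_Peps_tendsto:
  assumes sol: "\<And>\<epsilon>. 0 < \<epsilon> \<Longrightarrow> classical_sol_Peps n R f gR \<epsilon> (v \<epsilon>)"
    and mono: "\<And>\<epsilon>. 0 < \<epsilon> \<Longrightarrow> mono_on {0..R} (v \<epsilon>)"
    and c: "c \<in> {0<..<R}"
  shows "((\<lambda>\<epsilon>. deriv (v \<epsilon>) c) \<longlongrightarrow> p c) (at_right 0)"
proof (rule tendstoI)
  fix e :: real assume e: "0 < e"
  have "isCont p c"
    using cont_p c by (simp add: continuous_on_eq_continuous_at)
  then obtain d where d: "d > 0" "\<And>r. \<bar>r - c\<bar> < d \<Longrightarrow> \<bar>p r - p c\<bar> < e / 2"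
    using e unfolding continuous_at_eps_delta dist_real_def by (metis half_gt_zero)
  \<comment> \<open>The halves keep \<open>{c - h..c + h}\<close> strictly inside both
    \<open>{0<..<R}\<close> and the neighbourhood given by continuity.\<close>
  define h where "h = min (d / 2) (min (c / 2) ((R - c) / 2))"
  define a b where "a = c - h" and "b = c + h"
  have h: "0 < h" "h < d" "h < c" "h < R - c"
    using d(1) c by (auto simp: h_def min_less_iff_disj)
  then have ab: "0 < a" "a < b" "b < R" and mid: "(a + b) / 2 = c"
    by (auto simp: a_def b_def)
  have p_ab: "\<bar>p a - p c\<bar> < e / 2" "\<bar>p b - p c\<bar> < e / 2"
    using h d(2) by (auto simp: a_def b_def)
  define C where "C = real n * b ^ (n - 1) * (2 * (4 * max (p R) R / (b - a)\<^sup>2) + (real n - 1) *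
         (4 * max (p R) R / (b - a)\<^sup>2 * (b - a) / a + max (p R) R / a\<^sup>2))"
  have "((\<lambda>\<epsilon>. C * \<epsilon>) \<longlongrightarrow> 0) (at_right 0)"
    by (auto intro!: tendsto_eq_intros)
  then have "\<forall>\<^sub>F \<epsilon> in at_right 0. C * \<epsilon> < (e / 2) ^ n"
    using e by (intro order_tendstoD) auto
  moreover have "\<forall>\<^sub>F \<epsilon> in at_right 0. \<epsilon> \<in> {0<..<1::real}"
    by (rule eventually_at_right_real) simp
  ultimately show "\<forall>\<^sub>F \<epsilon> in at_right 0. dist (deriv (v \<epsilon>) c) (p c) < e"
  proof eventually_elim
    case (elim \<epsilon>)
    have "deriv (v \<epsilon>) ((a + b) / 2) \<in> {p a - e / 2..p b + e / 2}"
      by (rule Peps_gradient_facts(7)[OF sol mono])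
        (use elim ab e in \<open>auto simp: C_def\<close>)
    then show ?case
      using p_ab unfolding mid dist_real_def atLeastAtMost_iff by linarith
  qed
qed

end

section \<open>Passage to the limit under the integral\<close>

text \<open>Dominated convergence with majorant \<open>M * \<bar>g r\<bar>\<close>, along arbitrary
  sequences in \<open>{0<..<1}\<close> that tend to \<open>0\<close>. It serves both the weak-star
  limit and the L1 convergence of the gradients.\<close>

lemma bounded_convergence_at_right:
  fixes F :: "real \<Rightarrow> real \<Rightarrow> real"
  assumes g: "integrable (lebesgue_on {a<..<b}) g"
    and F: "\<And>\<epsilon>. \<epsilon> \<in> {0<..<1} \<Longrightarrow> continuous_on {a<..<b} (F \<epsilon>)"
    and bound: "\<And>\<epsilon> r. \<epsilon> \<in> {0<..<1} \<Longrightarrow> r \<in> {a<..<b} \<Longrightarrow> \<bar>F \<epsilon> r\<bar> \<le> M"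
    and G: "continuous_on {a<..<b} G"
    and lim: "\<And>r. r \<in> {a<..<b} \<Longrightarrow> ((\<lambda>\<epsilon>. F \<epsilon> r) \<longlongrightarrow> G r) (at_right 0)"
  shows "((\<lambda>\<epsilon>. integral\<^sup>L (lebesgue_on {a<..<b}) (\<lambda>r. F \<epsilon> r * g r))
    \<longlongrightarrow> integral\<^sup>L (lebesgue_on {a<..<b}) (\<lambda>r. G r * g r)) (at_right 0)"
proof (rule tendsto_at_right_sequentially[of 0 1])
  fix S :: "nat \<Rightarrow> real"
  assume S: "\<And>n. 0 < S n" "\<And>n. S n < 1" "S \<longlonglongrightarrow> 0"
  have S_right: "filterlim S (at_right 0) sequentially"
    using S by (auto simp: filterlim_at less_imp_neq[symmetric])
  show "(\<lambda>n. integral\<^sup>L (lebesgue_on {a<..<b}) (\<lambda>r. F (S n) r * g r))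
    \<longlonglongrightarrow> integral\<^sup>L (lebesgue_on {a<..<b}) (\<lambda>r. G r * g r)"
  proof (rule integral_dominated_convergence[where w = "\<lambda>r. M * \<bar>g r\<bar>"])
    show "(\<lambda>r. G r * g r) \<in> borel_measurable (lebesgue_on {a<..<b})"
      using continuous_imp_measurable_on_sets_lebesgue[OF G] g by (intro borel_measurable_times) auto
    show "(\<lambda>r. F (S n) r * g r) \<in> borel_measurable (lebesgue_on {a<..<b})" for n
      using continuous_imp_measurable_on_sets_lebesgue[OF F, of "S n"] g S
      by (intro borel_measurable_times) auto
    show "integrable (lebesgue_on {a<..<b}) (\<lambda>r. M * \<bar>g r\<bar>)"
      using g by auto
    show "AE r in lebesgue_on {a<..<b}. (\<lambda>n. F (S n) r * g r) \<longlonglongrightarrow> G r * g r"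
      using filterlim_compose[OF lim S_right] by (intro AE_I2 tendsto_mult_right) auto
    show "AE r in lebesgue_on {a<..<b}. norm (F (S n) r * g r) \<le> M * \<bar>g r\<bar>" for n
      using bound S by (intro AE_I2) (auto simp: abs_mult intro!: mult_right_mono)
  qed
qed simp

text \<open>Integrating \<open>h'\<close> from \<open>r\<close> to \<open>b\<close>, where
  \<open>h\<close> vanishes, gives a bound independent of \<open>r\<close>: L1 smallness of
  derivatives becomes uniform smallness of functions.\<close>

lemma abs_le_integral_abs_deriv:
  fixes h h' :: "real \<Rightarrow> real"
  assumes h: "continuous_on {a..b} h" "h b = 0"
    and der: "\<And>r. r \<in> {a<..<b} \<Longrightarrow> (h has_real_derivative h' r) (at r)"
    and h': "continuous_on {a<..<b} h'" "\<And>r. r \<in> {a<..<b} \<Longrightarrow> \<bar>h' r\<bar> \<le> M"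
    and r: "r \<in> {a..b}"
  shows "\<bar>h r\<bar> \<le> integral\<^sup>L (lebesgue_on {a<..<b}) (\<lambda>x. \<bar>h' x\<bar>)"
proof -
  \<comment> \<open>The bound \<open>M\<close> secures integrability on the open interval, where
    \<open>h'\<close> is known to be continuous.\<close>
  have int: "integrable (lebesgue_on {a<..<b}) (\<lambda>x. \<bar>h' x\<bar>)"
    using h' by (intro finite_measure.integrable_const_bound[where B = M] AE_I2
        continuous_imp_measurable_on_sets_lebesgue finite_measure_lebesgue_on continuous_intros) auto
  then have "((\<lambda>x. \<bar>h' x\<bar>) has_integral integral\<^sup>L (lebesgue_on {a<..<b}) (\<lambda>x. \<bar>h' x\<bar>)) {a<..<b}"
    by (intro has_integral_integral_lebesgue_on) auto
  then have hi: "((\<lambda>x. \<bar>h' x\<bar>) has_integral integral\<^sup>L (lebesgue_on {a<..<b}) (\<lambda>x. \<bar>h' x\<bar>)) {a..b}"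
    by (simp add: has_integral_Icc_iff_Ioo)
  then have io: "(\<lambda>x. \<bar>h' x\<bar>) integrable_on {r..b}"
    by (rule integrable_subinterval_real[OF has_integral_integrable]) (use r in auto)
  have "(h' has_integral (h b - h r)) {r..b}"
  proof (rule fundamental_theorem_of_calculus_interior)
    show "continuous_on {r..b} h"
      using h(1) by (rule continuous_on_subset) (use r in auto)
    show "(h has_vector_derivative h' x) (at x)" if "x \<in> {r<..<b}" for x
      using der[of x] that r by (simp add: has_real_derivative_iff_has_vector_derivative)
  qed (use r in auto)
  then have ftc: "h' integrable_on {r..b}" "integral {r..b} h' = - h r"
    using h(2) by (auto simp: has_integral_integrable integral_unique)
  have "\<bar>h r\<bar> = norm (integral {r..b} h')" by (simp add: ftc)
  also have "\<dots> \<le> integral {r..b} (\<lambda>x. \<bar>h' x\<bar>)"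
    by (rule Henstock_Kurzweil_Integration.integral_norm_bound_integral[OF ftc(1) io]) simp
  also have "\<dots> \<le> integral {a..b} (\<lambda>x. \<bar>h' x\<bar>)"
    using io hi r by (intro integral_subset_le) (auto simp: has_integral_integrable)
  also have "\<dots> = integral\<^sup>L (lebesgue_on {a<..<b}) (\<lambda>x. \<bar>h' x\<bar>)"
    using hi by (rule integral_unique)
  finally show ?thesis .
qed

section \<open>Convergence and identification of the limit\<close>

theorem theorem3p13:
  fixes n :: nat and R f0 gR :: real and f u :: "real \<Rightarrow> real"
    and ue :: "real \<Rightarrow> real \<Rightarrow> real"
  assumes n: "n \<ge> 2" and R: "R > 0"
    and f_cont: "continuous_on {0<..<R} f"
    and f0: "f0 > 0" and f_ge: "\<forall>r\<in>{0..R}. f r \<ge> f0"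
    and u_sol: "classical_sol_P n R f gR u" and u_convex: "convex_on {0..R} u"
    and ue_sol: "\<forall>\<epsilon>>0. classical_sol_Peps n R f gR \<epsilon> (ue \<epsilon>)"
    and ue_mono: "\<forall>\<epsilon>>0. mono_on {0..R} (ue \<epsilon>)"
  shows "\<exists>u0 :: real \<Rightarrow> real.
     (\<forall>r\<in>{0..R}. ((\<lambda>\<epsilon>. ue \<epsilon> r) \<longlongrightarrow> u0 r) (at_right 0)) \<and>
     (\<forall>K. compact K \<and> K \<subseteq> {0<..<R} \<longrightarrow> uniform_limit K ue u0 (at_right 0)) \<and>
     (\<forall>K. compact K \<and> K \<subseteq> {0<..<R} \<and> convex K \<longrightarrow> strictly_convex_on K u0) \<and>
     strictly_convex_on {0..R} u0 \<and>
     (\<forall>g :: real \<Rightarrow> real. integrable (lebesgue_on {0<..<R}) g \<longrightarrow>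
        ((\<lambda>\<epsilon>. integral\<^sup>L (lebesgue_on {0<..<R}) (\<lambda>r. deriv (ue \<epsilon>) r * g r))
          \<longlongrightarrow> integral\<^sup>L (lebesgue_on {0<..<R}) (\<lambda>r. deriv u0 r * g r)) (at_right 0)) \<and>
     (\<forall>r\<in>{0..R}. u0 r = u r)"
proof -
  obtain p where p:
    "\<And>r. r \<in> {0..R} \<Longrightarrow> (u has_real_derivative p r) (at r within {0..R})"
    "\<And>r. r \<in> {0<..<R} \<Longrightarrow> ((\<lambda>s. p s ^ n) has_real_derivative real n * r ^ (n - 1) * f r) (at r)"
    "u R = gR" "p 0 = 0" "mono_on {0..R} p" "\<And>r. r \<in> {0..R} \<Longrightarrow> 0 \<le> p r"
    "(p \<longlongrightarrow> 0) (at_right 0)" "continuous_on {0<..<R} p" "strict_mono_on {0<..<R} p"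
    using classical_sol_P_gradient[OF n R f0 f_ge u_sol u_convex] by blast
  interpret radial_monge_ampere_gradient n R f p
    using n R p by unfold_locales auto
  define M where "M = max (p R) R"
  have sol: "classical_sol_Peps n R f gR \<epsilon> (ue \<epsilon>)" "mono_on {0..R} (ue \<epsilon>)" if "0 < \<epsilon>" for \<epsilon>
    using that ue_sol ue_mono by auto
  note facts = Peps_gradient_facts[OF sol, folded M_def]
  have lim: "((\<lambda>\<epsilon>. deriv (ue \<epsilon>) r) \<longlongrightarrow> p r) (at_right 0)" if "r \<in> {0<..<R}" for r
    by (rule deriv_Peps_tendsto[OF _ _ that]) (use sol in auto)
  have cont: "continuous_on {0<..<R} (deriv (ue \<epsilon>))" if "\<epsilon> \<in> {0<..<1}" for \<epsilon>
    by (rule facts(3)) (use that in auto)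
  have u': "(u has_real_derivative p r) (at r)" if "r \<in> {0<..<R}" for r
    by (rule has_real_derivative_interior_Icc[OF p(1)]) (use that in auto)
  then have deriv_u: "deriv u r = p r" if "r \<in> {0<..<R}" for r
    using that by (intro DERIV_imp_deriv)
  have pM: "0 \<le> p r" "p r \<le> M" if "r \<in> {0<..<R}" for r
    using that p(6)[of r] mono_onD[OF p(5), of r R] by (auto simp: M_def)
  have bound: "\<bar>deriv (ue \<epsilon>) r\<bar> \<le> M" if "\<epsilon> \<in> {0<..<1}" "r \<in> {0<..<R}" for \<epsilon> r
    using that facts(5)[of \<epsilon> r] facts(6)[of \<epsilon> r] by auto
  have weak: "((\<lambda>\<epsilon>. integral\<^sup>L (lebesgue_on {0<..<R}) (\<lambda>r. deriv (ue \<epsilon>) r * g r))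
      \<longlongrightarrow> integral\<^sup>L (lebesgue_on {0<..<R}) (\<lambda>r. deriv u r * g r)) (at_right 0)"
    if g: "integrable (lebesgue_on {0<..<R}) g" for g
  proof -
    have "integral\<^sup>L (lebesgue_on {0<..<R}) (\<lambda>r. deriv u r * g r)
        = integral\<^sup>L (lebesgue_on {0<..<R}) (\<lambda>r. p r * g r)"
      by (rule Bochner_Integration.integral_cong) (auto simp: deriv_u)
    then show ?thesis
      using bounded_convergence_at_right[where F = "\<lambda>\<epsilon>. deriv (ue \<epsilon>)", OF g cont bound p(8) lim]
      by simp
  qed
  \<comment> \<open>\<open>I \<epsilon>\<close> is the L1 distance of the gradients. It dominates
    the uniform distance of \<open>ue \<epsilon>\<close> and \<open>u\<close>, since both equal
    \<open>gR\<close> at \<open>R\<close>.\<close>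
  define I where "I \<epsilon> = integral\<^sup>L (lebesgue_on {0<..<R}) (\<lambda>r. \<bar>deriv (ue \<epsilon>) r - p r\<bar>)" for \<epsilon>
  have I: "(I \<longlongrightarrow> 0) (at_right 0)"
  proof -
    \<comment> \<open>The test function is the constant \<open>1\<close>; the distances are bounded
      by \<open>2 * M\<close> and tend pointwise to \<open>0\<close>.\<close>
    have "((\<lambda>\<epsilon>. integral\<^sup>L (lebesgue_on {0<..<R}) (\<lambda>r. \<bar>deriv (ue \<epsilon>) r - p r\<bar> * 1))
      \<longlongrightarrow> integral\<^sup>L (lebesgue_on {0<..<R}) (\<lambda>r. 0 * 1)) (at_right 0)"
    proof (rule bounded_convergence_at_right)
      show "integrable (lebesgue_on {0<..<R}) (\<lambda>_. 1::real)"
        by (intro finite_measure.integrable_const finite_measure_lebesgue_on) auto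
      show "continuous_on {0<..<R} (\<lambda>r. \<bar>deriv (ue \<epsilon>) r - p r\<bar>)" if "\<epsilon> \<in> {0<..<1}" for \<epsilon>
        using that by (intro continuous_intros cont p(8)) auto
      show "\<bar>\<bar>deriv (ue \<epsilon>) r - p r\<bar>\<bar> \<le> 2 * M" if "\<epsilon> \<in> {0<..<1}" "r \<in> {0<..<R}" for \<epsilon> r
        using bound[OF that] pM[OF that(2)] by simp
      show "((\<lambda>\<epsilon>. \<bar>deriv (ue \<epsilon>) r - p r\<bar>) \<longlongrightarrow> 0) (at_right 0)" if "r \<in> {0<..<R}" for r
        using lim[OF that] by (intro tendsto_rabs_zero) (simp add: LIM_zero)
    qed simp
    then show ?thesis unfolding I_def by simp
  qed
  have diff: "\<bar>ue \<epsilon> r - u r\<bar> \<le> I \<epsilon>" if eps: "\<epsilon> \<in> {0<..<1}" and r: "r \<in> {0..R}" for \<epsilon> r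
    unfolding I_def
  proof (rule abs_le_integral_abs_deriv[OF _ _ _ _ _ r])
    have e: "0 < \<epsilon>" "\<epsilon> < 1" using eps by auto
    show "continuous_on {0..R} (\<lambda>r. ue \<epsilon> r - u r)"
      using facts(1)[OF e(1) e(1) e] DERIV_continuous_on[OF p(1)] by (rule continuous_on_diff)
    show "ue \<epsilon> R - u R = 0" using facts(2)[OF e(1) e(1) e] p(3) by simp
    show "((\<lambda>r. ue \<epsilon> r - u r) has_real_derivative deriv (ue \<epsilon>) r - p r) (at r)"
      if "r \<in> {0<..<R}" for r
      using facts(4)[OF e(1) e(1) e that] u'[OF that] by (rule DERIV_diff)
    show "continuous_on {0<..<R} (\<lambda>r. deriv (ue \<epsilon>) r - p r)"
      using cont[OF eps] p(8) by (rule continuous_on_diff)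
    show "\<bar>deriv (ue \<epsilon>) r - p r\<bar> \<le> 2 * M" if "r \<in> {0<..<R}" for r
      using bound[OF eps that] pM[OF that] by simp
  qed
  \<comment> \<open>Uniformity up to the boundary yields the pointwise limits on
    \<open>{0..R}\<close> and, by restriction, the uniform limits on compact subsets.\<close>
  have unif: "uniform_limit {0..R} ue u (at_right 0)"
  proof (rule uniform_limitI)
    fix e :: real assume "0 < e"
    with I have "\<forall>\<^sub>F \<epsilon> in at_right 0. I \<epsilon> < e" by (rule order_tendstoD)
    moreover have "\<forall>\<^sub>F \<epsilon> in at_right 0. \<epsilon> \<in> {0<..<1::real}"
      by (rule eventually_at_right_real) simp
    ultimately show "\<forall>\<^sub>F \<epsilon> in at_right 0. \<forall>r\<in>{0..R}. dist (ue \<epsilon> r) (u r) < e"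
      by eventually_elim (use diff in \<open>force simp: dist_real_def\<close>)
  qed
  have strict: "strictly_convex_on {0..R} u"
    by (rule strictly_convex_on_Icc[OF p(1) p(9)])
  have sub: "K \<subseteq> {0..R}" if "K \<subseteq> {0<..<R}" for K
    using that by force
  show ?thesis
    using tendsto_uniform_limitI[OF unif] uniform_limit_on_subset[OF unif sub]
      strictly_convex_on_subset[OF strict sub] strict weak
    \<comment> \<open>With \<open>u\<close> itself as the witness, the identification of the limit
      is immediate and the strict convexity of \<open>u\<close> passes to \<open>u0\<close>.\<close>
    by (intro exI[of _ u] conjI allI impI ballI) auto
qed

end
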